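(* Let $n\ge1$ and let $\Pi_n$ be a PES (partially exchangeable and stationary) random partition of $[n]$. Any one of the following two conditions implies that $\Pi_n$ is exchangeable: (i) $\Pi_n$ has at most two blocks almost surely; (ii) $n\le 4$.
   Context: $[n]=\{1,\dots,n\}$, and $\mathcal P_n$ is the finite set of all set partitions of $[n]$. A random partition of $[n]$ is a random variable $\Pi_n$ with values in $\mathcal P_n$. Blocks of a partition are listed in increasing order of their least elements; the shape $s(\pi_n)$ is the composition of $n$ given by the block sizes in this order, and the ranked shape $s^\downarrow(\pi_n)$ is the partition of the integer $n$ given by the block sizes in nonincreasing order. For $1\le j\le n$ the operator $D_j:\mathcal P_n\to\mathcal P_{n-1}$ deletes the element $j$ from its block (removing the block if it becomes empty) and then relabels the remaining elements by $[n-1]$ via the increasing bijection. $\Pi_n$ is partially exchangeable if $\mathbb P[\Pi_n=\pi_n]$ depends only on $s(\pi_n)$; stationary if $D_1\Pi_n\stackrel{d}{=}D_n\Pi_n$; PES if it is both partially exchangeable and stationary; exchangeable if $\mathbb P[\Pi_n=\pi_n]$ depends only on $s^\downarrow(\pi_n)$. *)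

theory Defs
  imports "HOL-Probability.Probability"
begin

definition set_partitions :: "nat \<Rightarrow> nat set set set" where
  "set_partitions n = {\<pi>. partition_on {1..n} \<pi>}"

text \<open>Distinct blocks of a partition are disjoint, hence have distinct minima, so the sort key is injective
  and the listing is well defined.\<close>

definition blocks :: "nat set set \<Rightarrow> nat set list" where
  "blocks \<pi> = sorted_key_list_of_set Min \<pi>"

definition shape :: "nat set set \<Rightarrow> nat list" where
  "shape \<pi> = map card (blocks \<pi>)"

definition ranked_shape :: "nat set set \<Rightarrow> nat list" where
  "ranked_shape \<pi> = rev (sort (map card (blocks \<pi>)))"

text \<open>On \<open>{1..n} - {j}\<close> this is the increasing bijection onto \<open>{1..n - 1}\<close>.\<close>

definition relabel :: "nat \<Rightarrow> nat \<Rightarrow> nat" where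
  "relabel j i = (if i < j then i else i - 1)"

definition delete_elem :: "nat \<Rightarrow> nat set set \<Rightarrow> nat set set" where
  "delete_elem j \<pi> = (\<lambda>B. relabel j ` (B - {j})) ` \<pi> - {{}}"

definition random_partition :: "nat \<Rightarrow> 'a measure \<Rightarrow> ('a \<Rightarrow> nat set set) \<Rightarrow> bool" where
  "random_partition n M X \<longleftrightarrow> prob_space M \<and> X \<in> measurable M (count_space (set_partitions n))"

definition partially_exchangeable :: "nat \<Rightarrow> 'a measure \<Rightarrow> ('a \<Rightarrow> nat set set) \<Rightarrow> bool" where
  "partially_exchangeable n M X \<longleftrightarrow>
     (\<forall>\<pi>\<in>set_partitions n. \<forall>\<pi>'\<in>set_partitions n. shape \<pi> = shape \<pi>' \<longrightarrow>
        \<P>(\<omega> in M. X \<omega> = \<pi>) = \<P>(\<omega> in M. X \<omega> = \<pi>'))"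

definition exchangeable :: "nat \<Rightarrow> 'a measure \<Rightarrow> ('a \<Rightarrow> nat set set) \<Rightarrow> bool" where
  "exchangeable n M X \<longleftrightarrow>
     (\<forall>\<pi>\<in>set_partitions n. \<forall>\<pi>'\<in>set_partitions n. ranked_shape \<pi> = ranked_shape \<pi>' \<longrightarrow>
        \<P>(\<omega> in M. X \<omega> = \<pi>) = \<P>(\<omega> in M. X \<omega> = \<pi>'))"

definition stationary :: "nat \<Rightarrow> 'a measure \<Rightarrow> ('a \<Rightarrow> nat set set) \<Rightarrow> bool" where
  "stationary n M X \<longleftrightarrow>
     distr M (count_space (set_partitions (n - 1))) (\<lambda>\<omega>. delete_elem 1 (X \<omega>)) =
     distr M (count_space (set_partitions (n - 1))) (\<lambda>\<omega>. delete_elem n (X \<omega>))"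

definition PES :: "nat \<Rightarrow> 'a measure \<Rightarrow> ('a \<Rightarrow> nat set set) \<Rightarrow> bool" where
  "PES n M X \<longleftrightarrow> partially_exchangeable n M X \<and> stationary n M X"

end

theory Submission imports Defs begin

text \<open>
  Write \<open>p\<close> for the probability of a partition as a function of its shape. Comparing the
  probabilities of \<open>D\<^sub>1 \<Pi> = \<sigma>\<close> and \<open>D\<^sub>n \<Pi> = \<sigma>\<close> for a one-block \<open>\<sigma>\<close> gives
  \<open>p [1, m] = p [m, 1]\<close>, and for \<open>\<sigma>\<close> of shape \<open>[a, b]\<close>, after cancelling \<open>p [a + 1, b]\<close>,
  it gives \<open>p [1, a, b] + p [b + 1, a] = p [a, b, 1] + p [a, b + 1]\<close>.
  If there are at most two blocks, the three-block terms vanish and \<open>p\<close> is symmetric.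
  If \<open>n \<le> 4\<close>, the only nontrivial rearrangements are those of \<open>[1, 2]\<close>, \<open>[1, 3]\<close> and
  \<open>[1, 1, 2]\<close>; the last follows from \<open>(a, b) = (1, 2)\<close> and \<open>(a, b) = (2, 1)\<close>.
\<close>

section \<open>Partitions that restrict to a given one when a point is removed\<close>

text \<open>Removing \<open>a\<close> alters only the block \<open>C\<close> that contains it.
  Either \<open>C = {a}\<close> and the block disappears, or \<open>C - {a}\<close> is a block of
  \<open>\<rho>\<close> to which \<open>a\<close> had been added.\<close>

lemma delete_point_fibre:
  assumes a: "a \<notin> A" and \<rho>: "partition_on A \<rho>"
  shows "{\<pi>. partition_on (insert a A) \<pi> \<and> (\<lambda>B. B - {a}) ` \<pi> - {{}} = \<rho>}
    = insert (insert {a} \<rho>) ((\<lambda>B. insert (insert a B) (\<rho> - {B})) ` \<rho>)" (is "?L = ?R")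
proof (intro equalityI subsetI)
  fix \<pi> assume "\<pi> \<in> ?L"
  then have p: "partition_on (insert a A) \<pi>" and r: "(\<lambda>B. B - {a}) ` \<pi> - {{}} = \<rho>" by auto
  obtain C where C: "C \<in> \<pi>" "a \<in> C"
    using partition_onD1[OF p] by blast
  have other: "a \<notin> B" if "B \<in> \<pi>" "B \<noteq> C" for B
    using partition_onD2[OF p] that C by (auto simp: disjoint_def)
  have ne: "{} \<notin> \<pi>" using p by (rule partition_onD3)
  have same: "(\<lambda>B. B - {a}) ` (\<pi> - {C}) = \<pi> - {C}"
    using other by (intro trans[OF image_cong image_ident]) auto
  have "(\<lambda>B. B - {a}) ` \<pi> = insert (C - {a}) (\<pi> - {C})"
    using same C(1) by (metis image_insert insert_Diff)
  then have r': "\<rho> = insert (C - {a}) (\<pi> - {C}) - {{}}" using r by simp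
  show "\<pi> \<in> ?R"
  proof (cases "C = {a}")
    case True
    then have "\<rho> = \<pi> - {C}" using r' ne by auto
    then show ?thesis using True C by auto
  next
    case False
    then have "C - {a} \<noteq> {}" using C by auto
    then have r'': "\<rho> = insert (C - {a}) (\<pi> - {C})" using r' ne by auto
    \<comment> \<open>Otherwise this nonempty part of \<open>C\<close> would be a second block
      meeting \<open>C\<close>. Hence taking it out of \<open>\<rho>\<close> leaves exactly the
      blocks of \<open>\<pi>\<close> other than \<open>C\<close>.\<close>
    have "C - {a} \<notin> \<pi>"
    proof
      assume "C - {a} \<in> \<pi>"
      moreover have "C - {a} \<noteq> C" using C by auto
      ultimately have "(C - {a}) \<inter> C = {}"
        using disjointD[OF partition_onD2[OF p] _ C(1)] by simp
      then show False using C \<open>C - {a} \<noteq> {}\<close> by auto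
    qed
    then have "\<pi> = insert (insert a (C - {a})) (\<rho> - {C - {a}})"
      using r'' C by (simp add: insert_absorb)
    then show ?thesis using r'' by blast
  qed
next
  fix \<pi> assume "\<pi> \<in> ?R"
  have ne: "{} \<notin> \<rho>" using \<rho> by (rule partition_onD3)
  have notin: "a \<notin> B" if "B \<in> \<rho>" for B using partition_onD1[OF \<rho>] a that by auto
  have same: "(\<lambda>B. B - {a}) ` \<sigma> = \<sigma>" if "\<sigma> \<subseteq> \<rho>" for \<sigma>
    using notin that by (intro trans[OF image_cong image_ident]) auto
  from \<open>\<pi> \<in> ?R\<close> consider "\<pi> = insert {a} \<rho>"
    | B where "B \<in> \<rho>" "\<pi> = insert (insert a B) (\<rho> - {B})" by blast
  then show "\<pi> \<in> ?L"
  proof cases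
    case 1
    have "partition_on (insert a A) \<pi>"
      unfolding 1 using \<rho> a notin by (subst partition_on_insert) (auto simp: disjnt_iff)
    then show ?thesis using 1 ne same[of \<rho>] by auto
  next
    case 2
    \<comment> \<open>Disjointness from the other blocks allows \<open>partition_on_insert\<close>
      to detach \<open>B\<close> and then to put \<open>insert a B\<close> in its place.\<close>
    have d: "disjnt B (\<Union>(\<rho> - {B}))"
      using partition_onD2[OF \<rho>] 2(1) by (auto simp: disjnt_def disjoint_def)
    have "partition_on A (insert B (\<rho> - {B}))" using \<rho> 2(1) by (simp add: insert_absorb)
    then have "partition_on (A - B) (\<rho> - {B})" "B \<subseteq> A" using partition_on_insert[OF d] by auto
    moreover have "insert a A - insert a B = A - B" using a by auto
    moreover have "disjnt (insert a B) (\<Union>(\<rho> - {B}))" using d notin by (auto simp: disjnt_iff)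
    ultimately have "partition_on (insert a A) \<pi>"
      unfolding 2 by (subst partition_on_insert) auto
    moreover have "B - {a} = B" using notin[OF 2(1)] by auto
    then have "(\<lambda>B. B - {a}) ` \<pi> = \<rho>"
      using 2(1) same[of "\<rho> - {B}"] by (auto simp: 2(2))
    ultimately show ?thesis using ne by auto
  qed
qed

text \<open>The members of the fibre are listed without repetition. Each has a single block
  containing \<open>a\<close>, and that block determines \<open>B\<close>; for it to be
  \<open>{a}\<close>, the block \<open>B\<close> would have to be empty.\<close>

lemma sum_delete_point_fibre:
  fixes q :: "'b set set \<Rightarrow> real"
  assumes a: "a \<notin> A" and A: "finite A" and \<rho>: "partition_on A \<rho>"
  shows "(\<Sum>\<pi> | partition_on (insert a A) \<pi> \<and> (\<lambda>B. B - {a}) ` \<pi> - {{}} = \<rho>. q \<pi>)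
    = q (insert {a} \<rho>) + (\<Sum>B\<in>\<rho>. q (insert (insert a B) (\<rho> - {B})))"
proof -
  have notin: "a \<notin> B" if "B \<in> \<rho>" for B using partition_onD1[OF \<rho>] a that by auto
  have "{} \<notin> \<rho>" using \<rho> by (rule partition_onD3)
  have inj: "inj_on (\<lambda>B. insert (insert a B) (\<rho> - {B})) \<rho>"
  proof (rule inj_onI)
    fix B C assume BC: "B \<in> \<rho>" "C \<in> \<rho>"
      and eq: "insert (insert a B) (\<rho> - {B}) = insert (insert a C) (\<rho> - {C})"
    then have "insert a B = insert a C" using notin by (metis Diff_iff insertCI insertE)
    then show "B = C" using notin BC by (metis insert_ident)
  qed
  have new: "insert {a} \<rho> \<notin> (\<lambda>B. insert (insert a B) (\<rho> - {B})) ` \<rho>"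
  proof
    assume "insert {a} \<rho> \<in> (\<lambda>B. insert (insert a B) (\<rho> - {B})) ` \<rho>"
    then obtain B where B: "B \<in> \<rho>" "insert {a} \<rho> = insert (insert a B) (\<rho> - {B})" by auto
    then have "{a} = insert a B" using notin by blast
    then have "B = {}" using notin[OF B(1)] by auto
    then show False using B(1) \<open>{} \<notin> \<rho>\<close> by simp
  qed
  show ?thesis
    unfolding delete_point_fibre[OF a \<rho>]
    using new inj finite_elements[OF A \<rho>] by (simp add: sum.reindex)
qed

section \<open>Relabelling and the deletion operators\<close>

lemma inj_on_relabel: "inj_on (relabel j) ({1..n} - {j})"
  by (auto simp: inj_on_def relabel_def split: if_splits)

lemma relabel_image: "j \<in> {1..n} \<Longrightarrow> relabel j ` ({1..n} - {j}) = {1..n - 1}"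
proof (intro equalityI subsetI)
  fix i assume j: "j \<in> {1..n}" and i: "i \<in> {1..n - 1}"
  show "i \<in> relabel j ` ({1..n} - {j})"
  proof (cases "i < j")
    case True
    then show ?thesis using i by (intro image_eqI[of _ _ i]) (auto simp: relabel_def)
  next
    case False
    then show ?thesis using i j by (intro image_eqI[of _ _ "Suc i"]) (auto simp: relabel_def)
  qed
qed (auto simp: relabel_def)

text \<open>Separates removal from relabelling, so that fibres can be described before relabelling.
  Images of nonempty sets are nonempty, hence empty blocks may be discarded first.\<close>

lemma delete_elem_alt:
  "delete_elem j \<pi> = (`) (relabel j) ` ((\<lambda>B. B - {j}) ` \<pi> - {{}})"
  by (auto simp: delete_elem_def)

lemma partition_on_delete_point:
  assumes "partition_on A \<pi>"
  shows "partition_on (A - {a}) ((\<lambda>B. B - {a}) ` \<pi> - {{}})"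
  using assms by (intro partition_on_transform) (auto simp: disjnt_def)

lemma partition_on_relabel:
  assumes "j \<in> {1..n}" "partition_on ({1..n} - {j}) \<rho>"
  shows "(`) (relabel j) ` \<rho> \<in> set_partitions (n - 1)"
proof -
  have "{} \<notin> (`) (relabel j) ` \<rho>" using partition_onD3[OF assms(2)] by auto
  then show ?thesis
    using partition_on_inj_image[OF assms(2) inj_on_relabel] relabel_image[OF assms(1)]
    by (simp add: set_partitions_def)
qed

lemma delete_elem_in_set_partitions:
  assumes "j \<in> {1..n}" "\<pi> \<in> set_partitions n"
  shows "delete_elem j \<pi> \<in> set_partitions (n - 1)"
  unfolding delete_elem_alt using assms
  by (intro partition_on_relabel partition_on_delete_point) (auto simp: set_partitions_def)

text \<open>Relabelling is injective on \<open>{1..n} - {j}\<close>, hence also on families of its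
  subsets, so prescribing the relabelled partition amounts to prescribing \<open>\<rho>\<close>.
  What remains is the fibre of removing a point.\<close>

lemma sum_delete_elem_fibre:
  fixes q :: "nat set set \<Rightarrow> real"
  assumes j: "j \<in> {1..n}" and \<rho>: "partition_on ({1..n} - {j}) \<rho>"
  shows "(\<Sum>\<pi> | \<pi> \<in> set_partitions n \<and> delete_elem j \<pi> = (`) (relabel j) ` \<rho>. q \<pi>)
    = q (insert {j} \<rho>) + (\<Sum>B\<in>\<rho>. q (insert (insert j B) (\<rho> - {B})))"
proof -
  have "delete_elem j \<pi> = (`) (relabel j) ` \<rho> \<longleftrightarrow> (\<lambda>B. B - {j}) ` \<pi> - {{}} = \<rho>"
    if "partition_on {1..n} \<pi>" for \<pi>
    unfolding delete_elem_alt
    using partition_onD1[OF partition_on_delete_point[OF that, of j]] partition_onD1[OF \<rho>]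
    by (intro inj_on_image_eq_iff[OF inj_on_image_Pow[OF inj_on_relabel[of j n]]]) blast+
  then have "{\<pi>. \<pi> \<in> set_partitions n \<and> delete_elem j \<pi> = (`) (relabel j) ` \<rho>}
      = {\<pi>. partition_on (insert j ({1..n} - {j})) \<pi> \<and> (\<lambda>B. B - {j}) ` \<pi> - {{}} = \<rho>}"
    using j by (auto simp: set_partitions_def insert_absorb)
  then show ?thesis using sum_delete_point_fibre[OF _ _ \<rho>, of j q] by simp
qed

section \<open>Blocks in order of their minima, and shapes\<close>

lemma
  assumes "\<pi> \<in> set_partitions n"
  shows finite_set_partition: "finite \<pi>"
    and finite_block: "B \<in> \<pi> \<Longrightarrow> finite B"
    and block_nonempty: "B \<in> \<pi> \<Longrightarrow> B \<noteq> {}"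
proof -
  have p: "partition_on {1..n} \<pi>" using assms by (simp add: set_partitions_def)
  show "finite \<pi>" using finite_elements[OF _ p] by simp
  show "finite B" if "B \<in> \<pi>"
    using partition_onD1[OF p] that by (metis Union_upper finite_atLeastAtMost finite_subset)
  show "B \<noteq> {}" if "B \<in> \<pi>" using partition_onD3[OF p] that by auto
qed

lemma inj_on_Min_blocks:
  assumes "\<pi> \<in> set_partitions n"
  shows "inj_on Min \<pi>"
proof (rule inj_onI)
  fix B C assume *: "B \<in> \<pi>" "C \<in> \<pi>" "Min B = Min C"
  then have "Min B \<in> B \<inter> C"
    using finite_block[OF assms] block_nonempty[OF assms] by (metis Int_iff Min_in)
  then show "B = C"
    using * assms by (auto simp: set_partitions_def partition_on_def disjoint_def)
qed

text \<open>Strictly increasing keys make the list distinct, and a distinct key-sorted listing of a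
  set is unique.\<close>

lemma (in linorder) sorted_key_list_of_set_eqI:
  assumes "inj_on f A" "finite A" "set xs = A" "sorted_wrt (<) (map f xs)"
  shows "sorted_key_list_of_set f A = xs"
proof -
  interpret folding_insort_key "(\<le>)" "(<)" A f
    by unfold_locales (rule assms(1))
  have "distinct xs" using assms(4) by (simp add: strict_sorted_iff distinct_map)
  then have "length xs = card A" using assms(3) by (simp add: distinct_card flip: assms(3))
  then show ?thesis using sorted_key_list_of_set_unique[OF subset_refl assms(2)] assms by blast
qed

lemma (in linorder)
  assumes "inj_on f A" "finite A"
  shows set_sorted_key_list_of_set: "set (sorted_key_list_of_set f A) = A"
    and distinct_sorted_key_list_of_set: "distinct (sorted_key_list_of_set f A)"
proof -
  interpret I: folding_insort_key "(\<le>)" "(<)" A f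
    by unfold_locales (rule assms(1))
  show "set (sorted_key_list_of_set f A) = A"
    by (rule I.set_sorted_key_list_of_set[OF subset_refl assms(2)])
  show "distinct (sorted_key_list_of_set f A)"
    using I.distinct_sorted_key_list_of_set[OF subset_refl] by (simp add: distinct_map)
qed

text \<open>Computes the shape of an explicit partition from a listing of its blocks by increasing
  minima.\<close>

lemma shape_eqI:
  assumes "\<pi> \<in> set_partitions n" "set Bs = \<pi>" "sorted_wrt (<) (map Min Bs)"
  shows "shape \<pi> = map card Bs"
  using sorted_key_list_of_set_eqI[OF inj_on_Min_blocks finite_set_partition] assms
  by (simp add: shape_def blocks_def)

lemma
  assumes "\<pi> \<in> set_partitions n"
  shows set_blocks: "set (blocks \<pi>) = \<pi>" and distinct_blocks: "distinct (blocks \<pi>)"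
  using inj_on_Min_blocks[OF assms] finite_set_partition[OF assms]
  by (simp_all add: blocks_def set_sorted_key_list_of_set distinct_sorted_key_list_of_set)

lemma length_shape:
  assumes "\<pi> \<in> set_partitions n"
  shows "length (shape \<pi>) = card \<pi>"
  using set_blocks[OF assms] distinct_blocks[OF assms]
  by (metis distinct_card length_map shape_def)

lemma sum_list_shape:
  assumes "\<pi> \<in> set_partitions n"
  shows "sum_list (shape \<pi>) = n"
proof -
  have p: "partition_on {1..n} \<pi>" using assms by (simp add: set_partitions_def)
  have "sum_list (shape \<pi>) = (\<Sum>B\<in>\<pi>. card B)"
    unfolding shape_def
    by (metis set_blocks[OF assms] distinct_blocks[OF assms] sum_list_distinct_conv_sum_set)
  also have "\<dots> = n" using product_partition[OF p] finite_block[OF assms] by simp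
  finally show ?thesis .
qed

lemma shape_pos:
  assumes "\<pi> \<in> set_partitions n" "k \<in> set (shape \<pi>)"
  shows "k > 0"
  using assms(2) finite_block[OF assms(1)] block_nonempty[OF assms(1)]
  by (auto simp: shape_def set_blocks[OF assms(1)] card_gt_0_iff)

text \<open>Sorting and reversing preserve the multiset, so equal ranked shapes make the shapes
  rearrangements of each other.\<close>

lemma mset_shape_eq:
  assumes "ranked_shape \<pi> = ranked_shape \<pi>'"
  shows "mset (shape \<pi>) = mset (shape \<pi>')"
  using assms unfolding ranked_shape_def shape_def by (metis mset_rev mset_sort)

section \<open>Stationarity as an equation between finite sums\<close>

text \<open>Both laws in the definition of stationarity are evaluated at \<open>{\<sigma>}\<close>,
  and each of the two events is split according to the value of \<open>X\<close>.\<close>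

lemma sum_delete_elem_fibre_eq:
  assumes n: "n \<ge> 1" and X: "random_partition n M X" and st: "stationary n M X"
    and \<sigma>: "\<sigma> \<in> set_partitions (n - 1)"
  shows "(\<Sum>\<pi> | \<pi> \<in> set_partitions n \<and> delete_elem 1 \<pi> = \<sigma>. \<P>(\<omega> in M. X \<omega> = \<pi>))
    = (\<Sum>\<pi> | \<pi> \<in> set_partitions n \<and> delete_elem n \<pi> = \<sigma>. \<P>(\<omega> in M. X \<omega> = \<pi>))"
proof -
  interpret prob_space M using X by (simp add: random_partition_def)
  have X': "X \<in> measurable M (count_space (set_partitions n))"
    using X by (simp add: random_partition_def)
  have fin: "finite (set_partitions n)"
    unfolding set_partitions_def by (intro finitely_many_partition_on) simp
  have *: "measure (distr M (count_space (set_partitions (n - 1))) (\<lambda>\<omega>. delete_elem j (X \<omega>))) {\<sigma>}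
    = (\<Sum>\<pi> | \<pi> \<in> set_partitions n \<and> delete_elem j \<pi> = \<sigma>. \<P>(\<omega> in M. X \<omega> = \<pi>))"
    if j: "j \<in> {1..n}" for j
  proof -
    let ?S = "{\<pi> \<in> set_partitions n. delete_elem j \<pi> = \<sigma>}"
    \<comment> \<open>The law of \<open>X\<close> lives on a finite discrete space, so the measure
      of a fibre is the sum over its points.\<close>
    let ?N = "distr M (count_space (set_partitions n)) X"
    interpret N: prob_space ?N using X' by (rule prob_space_distr)
    have m: "(\<lambda>\<omega>. delete_elem j (X \<omega>)) \<in> measurable M (count_space (set_partitions (n - 1)))"
      by (rule measurable_compose[OF X']) (use delete_elem_in_set_partitions[OF j] in auto)
    have "measure (distr M (count_space (set_partitions (n - 1))) (\<lambda>\<omega>. delete_elem j (X \<omega>))) {\<sigma>}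
      = measure M ((\<lambda>\<omega>. delete_elem j (X \<omega>)) -` {\<sigma>} \<inter> space M)"
      using m \<sigma> by (simp add: measure_distr)
    also have "(\<lambda>\<omega>. delete_elem j (X \<omega>)) -` {\<sigma>} \<inter> space M = X -` ?S \<inter> space M"
      using measurable_space[OF X'] by auto
    also have "measure M (X -` ?S \<inter> space M) = measure ?N ?S"
      using X' by (simp add: measure_distr)
    also have "\<dots> = (\<Sum>\<pi>\<in>?S. measure ?N {\<pi>})"
      using fin by (intro N.finite_measure_eq_sum_singleton) auto
    also have "\<dots> = (\<Sum>\<pi>\<in>?S. \<P>(\<omega> in M. X \<omega> = \<pi>))"
      using X' by (intro sum.cong refl) (auto simp: measure_distr vimage_def Int_def conj_commute)
    finally show ?thesis .
  qed
  show ?thesis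
    using *[of 1] *[of n] n st by (simp add: stationary_def)
qed

section \<open>Linear relations between the probabilities of shapes\<close>

lemma relabel_1_image: "relabel 1 ` {Suc a..Suc b} = {a..b}"
proof -
  have "relabel 1 (Suc i) = i" for i by (simp add: relabel_def)
  then show ?thesis by (simp only: image_Suc_atLeastAtMost[symmetric] image_image image_ident)
qed

lemma relabel_below_image: "b < j \<Longrightarrow> relabel j ` {a..b} = {a..b}"
  by (intro trans[OF image_cong image_ident]) (auto simp: relabel_def)

text \<open>Stationarity is applied to the one-block partition of \<open>{1..m}\<close>. As a
  singleton block, \<open>1\<close> is listed first and \<open>n\<close> last, which gives the two
  shapes.\<close>

lemma shape_swap_boundary:
  fixes q :: "nat set set \<Rightarrow> real" and p :: "nat list \<Rightarrow> real"
  assumes q: "\<And>\<pi>. \<pi> \<in> set_partitions n \<Longrightarrow> q \<pi> = p (shape \<pi>)"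
    and st: "\<And>\<sigma>. \<sigma> \<in> set_partitions (n - 1) \<Longrightarrow>
      (\<Sum>\<pi> | \<pi> \<in> set_partitions n \<and> delete_elem 1 \<pi> = \<sigma>. q \<pi>) =
      (\<Sum>\<pi> | \<pi> \<in> set_partitions n \<and> delete_elem n \<pi> = \<sigma>. q \<pi>)"
    and m: "m \<ge> 1" "n = m + 1"
  shows "p [1, m] = p [m, 1]"
proof -
  have A1: "{1..n} - {1} = {2..m+1}" and An: "{1..n} - {n} = {1..m}" using m by auto
  have r1: "partition_on ({1..n} - {1}) {{2..m+1}}"
    and rn: "partition_on ({1..n} - {n}) {{1..m}}"
    unfolding A1 An using m by (auto intro!: partition_on_space)
  have i1: "(`) (relabel 1) ` {{2..m+1}} = {{1..m}}"
    using relabel_1_image[of 1 m] by (simp add: numeral_2_eq_2)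
  have i2: "(`) (relabel n) ` {{1..m}} = {{1..m}}"
    using relabel_below_image[of m n 1] m by simp
  have "{{1..m}} \<in> set_partitions (n - 1)"
    using m by (auto simp: set_partitions_def intro: partition_on_space)
  from st[OF this] have "q (insert {1} {{2..m+1}}) + q {insert 1 {2..m+1}}
    = q (insert {n} {{1..m}}) + q {insert n {1..m}}"
    using sum_delete_elem_fibre[OF _ r1, of q] sum_delete_elem_fibre[OF _ rn, of q] m
    unfolding i1 i2 by simp
  \<comment> \<open>Joining the deleted element to the single block gives all of
    \<open>{1..n}\<close> on either side, so these two terms cancel.\<close>
  moreover have "insert 1 {2..m+1} = insert n {1..m}" using m by auto
  ultimately have "q {{1}, {2..m+1}} = q {{1..m}, {n}}" by (simp add: insert_commute)
  moreover have "{{1}, {2..m+1}} \<in> set_partitions n"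
    using m by (auto simp: set_partitions_def partition_on_def disjoint_def)
  moreover from this have "shape {{1}, {2..m+1}} = [1, m]"
    by (subst shape_eqI[where Bs = "[{1}, {2..m+1}]"]) (use m in auto)
  moreover have "{{1..m}, {n}} \<in> set_partitions n"
    using m by (auto simp: set_partitions_def partition_on_def disjoint_def)
  moreover from this have "shape {{1..m}, {n}} = [m, 1]"
    by (subst shape_eqI[where Bs = "[{1..m}, {n}]"]) (use m in \<open>auto simp: less_Suc_eq_le\<close>)
  ultimately show ?thesis using q by metis
qed

lemma partition_on_two:
  assumes "P \<union> Q = A" "P \<inter> Q = {}" "P \<noteq> {}" "Q \<noteq> {}"
  shows "partition_on A {P, Q}"
  using assms by (auto simp: partition_on_def disjoint_def)

lemma partition_on_three:
  assumes "P \<union> Q \<union> R = A" "P \<inter> Q = {}" "P \<inter> R = {}" "Q \<inter> R = {}" "P \<noteq> {}" "Q \<noteq> {}" "R \<noteq> {}"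
  shows "partition_on A {P, Q, R}"
  using assms by (auto simp: partition_on_def disjoint_def)

text \<open>Stationarity is applied to two consecutive intervals of lengths \<open>a\<close> and
  \<open>b\<close>. Adding \<open>n\<close> keeps the order of the blocks, whereas adding
  \<open>1\<close> moves the block that receives it to the front. Joining the first interval gives
  \<open>[a + 1, b]\<close> on both sides, and these terms cancel.\<close>

lemma shape_two_block_relation:
  fixes q :: "nat set set \<Rightarrow> real" and p :: "nat list \<Rightarrow> real"
  assumes q: "\<And>\<pi>. \<pi> \<in> set_partitions n \<Longrightarrow> q \<pi> = p (shape \<pi>)"
    and st: "\<And>\<sigma>. \<sigma> \<in> set_partitions (n - 1) \<Longrightarrow>
      (\<Sum>\<pi> | \<pi> \<in> set_partitions n \<and> delete_elem 1 \<pi> = \<sigma>. q \<pi>) =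
      (\<Sum>\<pi> | \<pi> \<in> set_partitions n \<and> delete_elem n \<pi> = \<sigma>. q \<pi>)"
    and ab: "a \<ge> 1" "b \<ge> 1" "n = a + b + 1"
  shows "p [1, a, b] + p [b + 1, a] = p [a, b, 1] + p [a, b + 1]"
proof -
  \<comment> \<open>The target partition is \<open>{A, B}\<close>. The primed intervals are its
    blocks shifted up by one, that is, before \<open>relabel 1\<close> is applied.\<close>
  define A B A' B' where "A = {1..a}" "B = {a+1..a+b}" "A' = {2..a+1}" "B' = {a+2..a+b+1}"
  note defs = this
  have D: "A \<inter> B = {}" "A' \<inter> B' = {}" "n \<notin> A" "n \<notin> B" "1 \<notin> A'" "1 \<notin> B'"
    "A \<noteq> {}" "B \<noteq> {}" "A' \<noteq> {}" "B' \<noteq> {}"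
    using ab by (auto simp: defs)
  \<comment> \<open>With distinct blocks, the sum over the two-element family splits into two
    terms.\<close>
  then have ne: "A \<noteq> B" "A' \<noteq> B'" by auto
  have U: "A' \<union> B' = {1..n} - {1}" "A \<union> B = {1..n} - {n}" "A \<union> B = {1..n - 1}"
    "insert 1 (A' \<union> B') = {1..n}" "insert n (A \<union> B) = {1..n}"
    using ab by (auto simp: defs)
  have iv: "Min {i..k} = i" if "i \<le> k" for i k :: nat
    using that by (intro Min_eqI) auto
  have Min: "Min A = 1" "Min B = a + 1" "Min A' = 2" "Min B' = a + 2"
    "Min (insert n A) = 1" "Min (insert n B) = a + 1"
    "Min (insert 1 A') = 1" "Min (insert 1 B') = 1"
    using ab by (auto simp: defs Min_insert iv)
  have card: "card A = a" "card B = b" "card A' = a" "card B' = b"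
    "card (insert n A) = a + 1" "card (insert n B) = b + 1"
    "card (insert 1 A') = a + 1" "card (insert 1 B') = b + 1"
    using ab by (auto simp: defs)
  have r1: "partition_on ({1..n} - {1}) {A', B'}" and rn: "partition_on ({1..n} - {n}) {A, B}"
    and s: "{A, B} \<in> set_partitions (n - 1)"
    unfolding set_partitions_def mem_Collect_eq using D U(1,2,3) by (simp_all add: partition_on_two)
  have i1: "(`) (relabel 1) ` {A', B'} = {A, B}"
    using relabel_1_image[of 1 a] relabel_1_image[of "a+1" "a+b"] by (simp add: numeral_2_eq_2 defs)
  have i2: "(`) (relabel n) ` {A, B} = {A, B}"
    using relabel_below_image[of a n 1] relabel_below_image[of "a+b" n "a+1"] ab by (simp add: defs)
  have "q {{1}, A', B'} + (q {insert 1 A', B'} + q {insert 1 B', A'})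
    = q {{n}, A, B} + (q {insert n A, B} + q {insert n B, A})"
    using st[OF s] sum_delete_elem_fibre[OF _ r1, of q] sum_delete_elem_fibre[OF _ rn, of q] ab ne
    unfolding i1 i2 by (simp add: insert_Diff_if)
  moreover have "{{1}, A', B'} \<in> set_partitions n" "{insert 1 A', B'} \<in> set_partitions n"
    "{insert 1 B', A'} \<in> set_partitions n" "{{n}, A, B} \<in> set_partitions n"
    "{insert n A, B} \<in> set_partitions n" "{insert n B, A} \<in> set_partitions n"
    unfolding set_partitions_def mem_Collect_eq
    using D U(4,5) by (simp_all add: partition_on_two partition_on_three Int_commute Un_commute)
  note P = this
  have "shape {{1}, A', B'} = [1, a, b]"
    by (subst shape_eqI[OF P(1), of "[{1}, A', B']"]) (use ab Min card in auto)
  moreover have "shape {insert 1 A', B'} = [a + 1, b]"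
    by (subst shape_eqI[OF P(2), of "[insert 1 A', B']"]) (use ab Min card in auto)
  \<comment> \<open>The second interval now contains \<open>1\<close>, so it overtakes the first one
    and the sizes appear in reverse order.\<close>
  moreover have "shape {insert 1 B', A'} = [b + 1, a]"
    by (subst shape_eqI[OF P(3), of "[insert 1 B', A']"]) (use ab Min card in auto)
  moreover have "shape {{n}, A, B} = [a, b, 1]"
    by (subst shape_eqI[OF P(4), of "[A, B, {n}]"]) (use ab Min card in auto)
  moreover have "shape {insert n A, B} = [a + 1, b]"
    by (subst shape_eqI[OF P(5), of "[insert n A, B]"]) (use ab Min card in auto)
  moreover have "shape {insert n B, A} = [a, b + 1]"
    by (subst shape_eqI[OF P(6), of "[A, insert n B]"]) (use ab Min card in auto)
  ultimately show ?thesis using P q by simp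
qed

section \<open>Rearrangements of short compositions\<close>

lemma mset_eq_two: "mset [x, y] = mset ys \<longleftrightarrow> ys = [x, y] \<or> ys = [y, x]"
proof
  assume *: "mset [x, y] = mset ys"
  then have "length ys = 2" by (metis length_Cons list.size(3) mset_eq_length numeral_2_eq_2)
  then obtain u v where "ys = [u, v]" by (auto simp: numeral_2_eq_2 length_Suc_conv)
  then show "ys = [x, y] \<or> ys = [y, x]" using * by (auto simp: add_eq_conv_ex)
qed auto

text \<open>A list with at most one entry is determined by its multiset, so only pairs admit a
  nontrivial rearrangement.\<close>

lemma mset_eq_short:
  assumes "mset xs = mset ys" "length xs \<le> 2"
  shows "xs = ys \<or> (\<exists>x y. xs = [x, y] \<and> ys = [y, x])"
proof -
  consider "xs = []" | x where "xs = [x]" | x y where "xs = [x, y]"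
    using assms(2) by (cases xs rule: remdups_adj.cases) (auto simp: Suc_le_eq)
  then show ?thesis
  proof cases
    case 3
    then show ?thesis using mset_eq_two[of x y ys] assms(1) by auto
  qed (use assms(1) in auto)
qed

text \<open>Three positive parts use up three units. At most one unit is left, and it is absent,
  enlarges one of the three parts, or forms a fourth part.\<close>

lemma composition_le_4:
  fixes xs :: "nat list"
  assumes "sum_list xs \<le> 4" "\<And>x. x \<in> set xs \<Longrightarrow> x > 0" "length xs > 2"
  shows "xs \<in> {[1, 1, 1], [1, 1, 1, 1], [1, 1, 2], [1, 2, 1], [2, 1, 1]}"
proof -
  obtain x y z zs where xs: "xs = x # y # z # zs"
    using assms(3) by (cases xs; cases "tl xs"; cases "tl (tl xs)") auto
  have pos: "x > 0" "y > 0" "z > 0" using assms(2) by (auto simp: xs)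
  show ?thesis
  proof (cases zs)
    case Nil
    have "x + y + z \<le> 4" using assms(1) by (simp add: xs Nil)
    then have "x = 1 \<and> y = 1 \<and> z = 1 \<or> x = 1 \<and> y = 1 \<and> z = 2 \<or> x = 1 \<and> y = 2 \<and> z = 1
      \<or> x = 2 \<and> y = 1 \<and> z = 1" using pos by arith
    then show ?thesis by (auto simp: xs Nil)
  next
    case (Cons w ws)
    have "w > 0" "x + y + z + w + sum_list ws \<le> 4" using assms(1,2) by (auto simp: xs Cons)
    then have *: "x = 1" "y = 1" "z = 1" "w = 1" "sum_list ws = 0" using pos by arith+
    have "ws = []"
      using *(5) assms(2) by (cases ws) (auto simp: xs Cons)
    then show ?thesis using * by (simp add: xs Cons)
  qed
qed

section \<open>Exchangeability in the two cases\<close>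

theorem proposition9:
  fixes n :: nat and M :: "'a measure" and X :: "'a \<Rightarrow> nat set set"
  assumes "n \<ge> 1"
    and "random_partition n M X"
    and "PES n M X"
    and "(AE \<omega> in M. card (X \<omega>) \<le> 2) \<or> n \<le> 4"
  shows "exchangeable n M X"
proof -
  interpret prob_space M using assms(2) by (simp add: random_partition_def)
  define q where "q \<pi> = \<P>(\<omega> in M. X \<omega> = \<pi>)" for \<pi>
  \<comment> \<open>The probability of a shape is read off from a chosen representative. The default
    \<open>0\<close> lets \<open>p\<close> vanish on every list with more than two entries in the
    two-block case, without checking which lists are shapes.\<close>
  define p where
    "p c = (if \<exists>\<pi>\<in>set_partitions n. shape \<pi> = c
      then q (SOME \<pi>. \<pi> \<in> set_partitions n \<and> shape \<pi> = c) else 0)" for c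
  have q: "q \<pi> = p (shape \<pi>)" if "\<pi> \<in> set_partitions n" for \<pi>
  proof -
    define \<rho> where "\<rho> = (SOME \<pi>'. \<pi>' \<in> set_partitions n \<and> shape \<pi>' = shape \<pi>)"
    have "\<exists>\<pi>'. \<pi>' \<in> set_partitions n \<and> shape \<pi>' = shape \<pi>" using that by auto
    then have "\<rho> \<in> set_partitions n \<and> shape \<rho> = shape \<pi>" unfolding \<rho>_def by (rule someI_ex)
    moreover have "p (shape \<pi>) = q \<rho>" unfolding p_def \<rho>_def by (rule if_P) (use that in blast)
    \<comment> \<open>Partial exchangeability makes the choice of representative immaterial.\<close>
    moreover have "q \<pi> = q \<rho>" if "\<rho> \<in> set_partitions n" "shape \<pi> = shape \<rho>"
      using assms(3) \<open>\<pi> \<in> set_partitions n\<close> that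
      unfolding PES_def partially_exchangeable_def q_def by blast
    ultimately show ?thesis by simp
  qed
  have st: "(\<Sum>\<pi> | \<pi> \<in> set_partitions n \<and> delete_elem 1 \<pi> = \<sigma>. q \<pi>) =
      (\<Sum>\<pi> | \<pi> \<in> set_partitions n \<and> delete_elem n \<pi> = \<sigma>. q \<pi>)"
    if "\<sigma> \<in> set_partitions (n - 1)" for \<sigma>
    unfolding q_def using assms(3)
    unfolding PES_def by (intro sum_delete_elem_fibre_eq assms(1,2) that) blast
  note boundary = shape_swap_boundary[of n q p, OF q st]
    and relation = shape_two_block_relation[of n q p, OF q st]
  have "q \<pi> = q \<pi>'" if \<pi>: "\<pi> \<in> set_partitions n" "\<pi>' \<in> set_partitions n"
    and eq: "ranked_shape \<pi> = ranked_shape \<pi>'" for \<pi> \<pi>'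
  proof -
    note ms = mset_shape_eq[OF eq]
    note shape_simps = sum_list_shape[OF \<pi>(1)] sum_list_shape[OF \<pi>(2)]
    note pos = shape_pos[OF \<pi>(1)] shape_pos[OF \<pi>(2)]
    have short: "p (shape \<pi>) = p (shape \<pi>')"
      if len: "length (shape \<pi>) \<le> 2"
        and swap: "\<And>x y. x > 0 \<Longrightarrow> y > 0 \<Longrightarrow> x + y = n \<Longrightarrow> p [x, y] = p [y, x]"
      using mset_eq_short[OF ms len]
    proof (elim disjE exE conjE)
      fix x y assume xy: "shape \<pi> = [x, y]" "shape \<pi>' = [y, x]"
      have "x > 0" "y > 0" using pos(1) by (auto simp: xy(1))
      moreover have "x + y = n" using shape_simps(1) by (simp add: xy(1))
      ultimately show ?thesis using swap xy by simp
    qed simp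
    from assms(4) have "p (shape \<pi>) = p (shape \<pi>')"
    proof
      assume le2: "AE \<omega> in M. card (X \<omega>) \<le> 2"
      have q0: "q \<rho> = 0" if "card \<rho> > 2" for \<rho>
      proof -
        have "AE \<omega> in M. X \<omega> \<noteq> \<rho>" using le2 that by auto
        then show ?thesis unfolding q_def by (simp add: measure_def emeasure_eq_0_AE)
      qed
      have p0: "p c = 0" if "length c > 2" for c
      proof (cases "\<exists>\<rho>\<in>set_partitions n. shape \<rho> = c")
        case True
        then show ?thesis using q q0 length_shape that by metis
      qed (simp add: p_def)
      have swap: "p [x, y] = p [y, x]" if xy: "x > 0" "y > 0" "x + y = n" for x y
      \<comment> \<open>The relation is used with \<open>(a, b) = (x, y - 1)\<close>, which requires
        \<open>y > 1\<close>; for \<open>y = 1\<close> the swap is the boundary identity.\<close>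
      proof (cases "y = 1")
        case True
        then show ?thesis using boundary[of x] xy by simp
      next
        case False
        define b where "b = y - 1"
        have b: "b \<ge> 1" "y = b + 1" "n = x + b + 1" using False xy by (auto simp: b_def)
        have "p [1, x, b] = 0" "p [x, b, 1] = 0" by (auto intro: p0)
        then show ?thesis using relation[of x b] b xy(1) by simp
      qed
      show ?thesis
      proof (cases "length (shape \<pi>) \<le> 2")
        case True
        then show ?thesis using swap by (rule short)
      next
        case False
        then show ?thesis using p0 mset_eq_length[OF ms] by simp
      qed
    next
      assume n4: "n \<le> 4"
      show ?thesis
      proof (cases "length (shape \<pi>) \<le> 2")
        case True
        have swap: "p [x, y] = p [y, x]" if xy: "x > 0" "y > 0" "x + y = n" for x y
        proof -
          have "x = 1 \<or> y = 1 \<or> x = y" using xy n4 by arith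
          then show ?thesis using boundary[of x] boundary[of y] xy by auto
        qed
        show ?thesis using True swap by (rule short)
      next
        case False
        let ?L = "{[1, 1, 1], [1, 1, 1, 1], [1, 1, 2], [1, 2, 1], [2, 1, 1]} :: nat list set"
        have "shape \<pi> \<in> ?L" "shape \<pi>' \<in> ?L"
          using False mset_eq_length[OF ms] n4 shape_simps pos
          by (intro composition_le_4; simp)+
        \<comment> \<open>The pair \<open>(1, 2)\<close> gives
          \<open>p [1, 1, 2] = p [1, 2, 1]\<close> after cancelling
          \<open>p [3, 1] = p [1, 3]\<close>; the pair \<open>(2, 1)\<close> gives
          \<open>p [1, 2, 1] = p [2, 1, 1]\<close> after cancelling \<open>p [2, 2]\<close>.\<close>
        moreover have eq4: "p [1, 1, 2] = p [2, 1, 1]" "p [1, 2, 1] = p [2, 1, 1]" if "n = 4"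
          using relation[of 1 2] relation[of 2 1] boundary[of 3] that
          by (simp_all add: numeral_2_eq_2 numeral_3_eq_3)
        \<comment> \<open>Within \<open>?L\<close>, length and set of entries already tell the
          rearrangement classes apart. The sum condition supplies \<open>n = 4\<close>, which
          \<open>eq4\<close> needs.\<close>
        have "p c = p c'" if "c \<in> ?L" "c' \<in> ?L" "set c = set c'" "length c = length c'"
          "sum_list c = n" for c c'
          using that(1,2)
          by (elim insertE emptyE; insert that(3-5); hypsubst; simp add: eq4[unfolded One_nat_def])
        ultimately show ?thesis
          using mset_eq_setD[OF ms] mset_eq_length[OF ms] shape_simps(1) by blast
      qed
    qed
    then show ?thesis using q \<pi> by simp
  qed
  then show ?thesis unfolding exchangeable_def q_def by blast
qed

end
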